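(* Let $K$ be a $b$-complete idempotent semiring, $W$ a $b$-complete idempotent semimodule over $K$, $X$ a nonempty set, and $V\subset K(X)$ an admissible functional $\wedge$-semimodule on $X$. Then each $b$-linear operator $A\colon V\to W$ has an integral representation: there is a map $k\colon X\to W$ such that for every $f\in V$ the set $\{f(x)\odot k(x)\mid x\in X\}$ is bounded in $W$ and $$Af=\bigoplus_{x\in X} f(x)\odot k(x).$$ In particular, if $W$ is a $b$-subsemimodule of $K(Y)$ for a nonempty set $Y$, then there is a function $k\colon X\times Y\to K$ such that $k(x,\cdot)\in W$ for each $x\in X$, for each $f\in V$ the set $\{f(x)\odot k(x,\cdot)\mid x\in X\}$ is bounded in $W$, and $$(Af)(y)=\bigoplus_{x\in X} f(x)\odot k(x,y)\qquad\text{for all } f\in V,\ y\in Y.$$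
   Context: An idempotent semigroup is a commutative additive semigroup $(S,\oplus)$ with $x\oplus x = x$ for all $x$; it carries the canonical partial order $x \preccurlyeq y \iff x\oplus y = y$, so $x \oplus y = \sup\{x,y\}$. For $Q\subset S$, $\bigoplus Q$ denotes $\sup Q$ when it exists; "bounded" means bounded above. $S$ is $b$-complete if $\bigoplus Q$ exists for every bounded subset $Q$, including the empty one. An idempotent semiring $K$ is an idempotent semigroup with an associative multiplication $\odot$ distributing over $\oplus$ on both sides, a zero $\mathbf 0$ (neutral for $\oplus$, absorbing for $\odot$) and a unit $\mathbf 1\neq\mathbf 0$. It is $b$-complete if it is $b$-complete as a semigroup and $k\odot\bigoplus Q=\bigoplus (k\odot Q)$, $(\bigoplus Q)\odot k=\bigoplus (Q\odot k)$ for all bounded $Q\subset K$, $k\in K$. An idempotent semimodule over $K$ is an idempotent semigroup $V$ with zero $\mathbf 0$ and a product $k\odot x\in V$ ($k\in K$, $x\in V$) satisfying the usual module axioms. It is $b$-complete if it is $b$-complete as a semigroup and $(\bigoplus Q)\odot x=\bigoplus(Q\odot x)$, $k\odot\bigoplus P=\bigoplus(k\odot P)$ for all bounded $Q\subset K$, $P\subset V$ and all $x\in V$, $k\in K$. A homomorphism $g$ of $b$-complete idempotent semigroups is a $b$-homomorphism if $g(\bigoplus P)=\bigoplus g(P)$ for every bounded $P$. A map $g$ between $b$-complete semimodules over $K$ is $b$-linear if it is linear ($g(x\oplus y)=g(x)\oplus g(y)$, $g(k\odot x)=k\odot g(x)$) and a $b$-homomorphism. $K(X)$ is the semimodule of all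 maps $X\to K$ with pointwise operations; it is $b$-complete. A subset of a semimodule is a subsemimodule if it is closed under addition and multiplication by scalars; a subsemimodule of a $b$-complete semimodule is a $b$-subsemimodule if the embedding map is a $b$-homomorphism (the subsemimodule itself being $b$-complete). An idempotent functional semimodule (IFS) on $X$ is a subset of $K(X)$ that is invariant under multiplication by scalars and is an upper semilattice with respect to the induced order. It is always regarded as a semimodule with the induced multiplication by scalars and the addition $x\oplus y=\sup\{x,y\}$, the supremum being taken inside the IFS (not in $K(X)$). An IFS on $X$ is a functional $\wedge$-semimodule if it contains the zero function $\mathbf 0$ and is closed under taking infima (in $K(X)$) of nonempty subsets; it is then regarded as a $b$-complete semimodule, with suprema of bounded subsets taken inside it. A functional semimodule $V\subset K(X)$ is admissible if for each $f\in V$ and each $x\in X$ there exists $g\in V$ such that $g(x)=\mathbf 1$ and $f(x)\odot g\preccurlyeq f$. *)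

theory Defs
  imports Main "HOL-Library.Function_Algebras"
begin

section \<open>Idempotent semigroups\<close>

definition is_sup :: "'a set \<Rightarrow> ('a \<Rightarrow> 'a \<Rightarrow> bool) \<Rightarrow> 'a set \<Rightarrow> 'a \<Rightarrow> bool" where
  "is_sup C le Q s \<longleftrightarrow>
     s \<in> C \<and> (\<forall>q\<in>Q. le q s) \<and> (\<forall>u\<in>C. (\<forall>q\<in>Q. le q u) \<longrightarrow> le s u)"

definition is_inf :: "'a set \<Rightarrow> ('a \<Rightarrow> 'a \<Rightarrow> bool) \<Rightarrow> 'a set \<Rightarrow> 'a \<Rightarrow> bool" where
  "is_inf C le Q s \<longleftrightarrow>
     s \<in> C \<and> (\<forall>q\<in>Q. le s q) \<and> (\<forall>u\<in>C. (\<forall>q\<in>Q. le u q) \<longrightarrow> le u s)"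

record 'a isemigroup =
  carrier :: "'a set"
  add :: "'a \<Rightarrow> 'a \<Rightarrow> 'a" (infixl "\<oplus>\<index>" 65)

locale idempotent_semigroup =
  fixes S :: "('a, 'b) isemigroup_scheme" (structure)
  assumes add_closed: "x \<in> carrier S \<Longrightarrow> y \<in> carrier S \<Longrightarrow> x \<oplus> y \<in> carrier S"
    and add_assoc: "x \<in> carrier S \<Longrightarrow> y \<in> carrier S \<Longrightarrow> z \<in> carrier S \<Longrightarrow>
      (x \<oplus> y) \<oplus> z = x \<oplus> (y \<oplus> z)"
    and add_comm: "x \<in> carrier S \<Longrightarrow> y \<in> carrier S \<Longrightarrow> x \<oplus> y = y \<oplus> x"
    and add_idem: "x \<in> carrier S \<Longrightarrow> x \<oplus> x = x"

definition sle :: "('a, 'b) isemigroup_scheme \<Rightarrow> 'a \<Rightarrow> 'a \<Rightarrow> bool" (infix "\<preceq>\<index>" 50) where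
  "x \<preceq>\<^bsub>S\<^esub> y \<longleftrightarrow> x \<oplus>\<^bsub>S\<^esub> y = y"

definition bdd :: "('a, 'b) isemigroup_scheme \<Rightarrow> 'a set \<Rightarrow> bool" where
  "bdd S Q \<longleftrightarrow> Q \<subseteq> carrier S \<and> (\<exists>u\<in>carrier S. \<forall>q\<in>Q. q \<preceq>\<^bsub>S\<^esub> u)"

text \<open>The supremum taken inside \<open>S\<close>; meaningful only when it exists, and then unique.\<close>

definition bigsum :: "('a, 'b) isemigroup_scheme \<Rightarrow> 'a set \<Rightarrow> 'a" ("\<Oplus>\<index>_" [90] 90) where
  "\<Oplus>\<^bsub>S\<^esub>Q = (THE s. is_sup (carrier S) (sle S) Q s)"

text \<open>The empty subset is listed separately, so that an empty \<open>S\<close> is not \<open>b\<close>-complete.\<close>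

locale b_complete_semigroup = idempotent_semigroup S
  for S :: "('a, 'b) isemigroup_scheme" (structure) +
  assumes sup_ex: "Q = {} \<or> bdd S Q \<Longrightarrow> \<exists>s. is_sup (carrier S) (sle S) Q s"

definition b_hom ::
  "('a, 'c) isemigroup_scheme \<Rightarrow> ('b, 'd) isemigroup_scheme \<Rightarrow> ('a \<Rightarrow> 'b) \<Rightarrow> bool" where
  "b_hom S T g \<longleftrightarrow>
     (\<forall>x\<in>carrier S. g x \<in> carrier T) \<and>
     (\<forall>x\<in>carrier S. \<forall>y\<in>carrier S. g (x \<oplus>\<^bsub>S\<^esub> y) = g x \<oplus>\<^bsub>T\<^esub> g y) \<and>
     (\<forall>P. bdd S P \<longrightarrow> g (\<Oplus>\<^bsub>S\<^esub>P) = \<Oplus>\<^bsub>T\<^esub>(g ` P))"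


section \<open>Idempotent semirings\<close>

text \<open>
  \<open>semiring_1\<close> does not ask multiplication to be commutative; it includes
  \<open>0 \<noteq> 1\<close> and the absorption laws for \<open>0\<close>.
\<close>

class idempotent_semiring = semiring_1 +
  assumes plus_idem: "x + x = x"

definition univ_sg :: "('a \<Rightarrow> 'a \<Rightarrow> 'a) \<Rightarrow> 'a isemigroup" where
  "univ_sg p = \<lparr>carrier = UNIV, add = p\<rparr>"

class b_complete_idempotent_semiring = idempotent_semiring +
  assumes b_complete_plus: "b_complete_semigroup (univ_sg (+))"
    and mult_bigsum: "bdd (univ_sg (+)) Q \<Longrightarrow>
      k * (\<Oplus>\<^bsub>univ_sg (+)\<^esub>Q) = \<Oplus>\<^bsub>univ_sg (+)\<^esub>((\<lambda>q. k * q) ` Q)"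
    and bigsum_mult: "bdd (univ_sg (+)) Q \<Longrightarrow>
      (\<Oplus>\<^bsub>univ_sg (+)\<^esub>Q) * k = \<Oplus>\<^bsub>univ_sg (+)\<^esub>((\<lambda>q. q * k) ` Q)"


section \<open>Idempotent semimodules\<close>

record ('k, 'v) isemimodule = "'v isemigroup" +
  zero :: "'v" ("\<zero>\<index>")
  smult :: "'k \<Rightarrow> 'v \<Rightarrow> 'v" (infixr "\<odot>\<index>" 70)

text \<open>
  The law \<open>k \<odot> \<zero> = \<zero>\<close> follows from \<open>zero_smult\<close> and \<open>smult_assoc\<close>.
\<close>

locale idempotent_semimodule = idempotent_semigroup M
  for M :: "('k::idempotent_semiring, 'v) isemimodule" (structure) +
  assumes zero_closed: "\<zero> \<in> carrier M"
    and zero_add: "x \<in> carrier M \<Longrightarrow> \<zero> \<oplus> x = x"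
    and smult_closed: "x \<in> carrier M \<Longrightarrow> k \<odot> x \<in> carrier M"
    and smult_add: "x \<in> carrier M \<Longrightarrow> y \<in> carrier M \<Longrightarrow>
      k \<odot> (x \<oplus> y) = (k \<odot> x) \<oplus> (k \<odot> y)"
    and plus_smult: "x \<in> carrier M \<Longrightarrow> (k + l) \<odot> x = (k \<odot> x) \<oplus> (l \<odot> x)"
    and smult_assoc: "x \<in> carrier M \<Longrightarrow> (k * l) \<odot> x = k \<odot> (l \<odot> x)"
    and one_smult: "x \<in> carrier M \<Longrightarrow> 1 \<odot> x = x"
    and zero_smult: "x \<in> carrier M \<Longrightarrow> 0 \<odot> x = \<zero>"

locale b_complete_semimodule = idempotent_semimodule M + b_complete_semigroup M
  for M :: "('k::b_complete_idempotent_semiring, 'v) isemimodule" (structure) +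
  assumes bigsum_smult: "bdd (univ_sg (+)) Q \<Longrightarrow> x \<in> carrier M \<Longrightarrow>
      (\<Oplus>\<^bsub>univ_sg (+)\<^esub>Q) \<odot> x = \<Oplus>((\<lambda>q. q \<odot> x) ` Q)"
    and smult_bigsum: "bdd M P \<Longrightarrow> k \<odot> (\<Oplus>P) = \<Oplus>((\<lambda>p. k \<odot> p) ` P)"

definition b_linear ::
  "('k, 'v) isemimodule \<Rightarrow> ('k, 'w) isemimodule \<Rightarrow> ('v \<Rightarrow> 'w) \<Rightarrow> bool" where
  "b_linear M N A \<longleftrightarrow>
     b_hom M N A \<and> (\<forall>k. \<forall>x\<in>carrier M. A (k \<odot>\<^bsub>M\<^esub> x) = k \<odot>\<^bsub>N\<^esub> A x)"

definition restrict_module ::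
  "('k, 'v) isemimodule \<Rightarrow> 'v set \<Rightarrow> ('k, 'v) isemimodule" where
  "restrict_module M U = M\<lparr>carrier := U\<rparr>"

definition subsemimodule :: "'v set \<Rightarrow> ('k, 'v) isemimodule \<Rightarrow> bool" where
  "subsemimodule U M \<longleftrightarrow> U \<subseteq> carrier M \<and>
     (\<forall>x\<in>U. \<forall>y\<in>U. x \<oplus>\<^bsub>M\<^esub> y \<in> U) \<and> (\<forall>k. \<forall>x\<in>U. k \<odot>\<^bsub>M\<^esub> x \<in> U)"

definition b_subsemimodule ::
  "'v set \<Rightarrow> ('k::b_complete_idempotent_semiring, 'v) isemimodule \<Rightarrow> bool" where
  "b_subsemimodule U M \<longleftrightarrow> subsemimodule U M \<and>
     b_complete_semimodule (restrict_module M U) \<and>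
     b_hom (restrict_module M U) M (\<lambda>x. x)"


section \<open>Functional semimodules\<close>

text \<open>The semimodule of all maps \<open>'x \<Rightarrow> 'k\<close>; the index set is the type \<open>'x\<close>.\<close>

definition fun_module :: "('k::idempotent_semiring, 'x \<Rightarrow> 'k) isemimodule" where
  "fun_module = \<lparr>carrier = UNIV, add = (+), zero = 0, smult = (\<lambda>k f x. k * f x)\<rparr>"

definition is_ifs :: "('x \<Rightarrow> 'k::idempotent_semiring) set \<Rightarrow> bool" where
  "is_ifs V \<longleftrightarrow>
     (\<forall>k. \<forall>f\<in>V. k \<odot>\<^bsub>fun_module\<^esub> f \<in> V) \<and>
     (\<forall>f\<in>V. \<forall>g\<in>V. \<exists>h. is_sup V (sle fun_module) {f, g} h)"

text \<open>
  The sum of two elements is their supremum inside \<open>V\<close>, which in general differs from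
  their pointwise sum.
\<close>

definition ifs_module ::
  "('x \<Rightarrow> 'k::idempotent_semiring) set \<Rightarrow> ('k, 'x \<Rightarrow> 'k) isemimodule" where
  "ifs_module V = fun_module\<lparr>carrier := V,
     add := (\<lambda>f g. THE h. is_sup V (sle fun_module) {f, g} h)\<rparr>"

definition functional_wedge_semimodule ::
  "('x \<Rightarrow> 'k::b_complete_idempotent_semiring) set \<Rightarrow> bool" where
  "functional_wedge_semimodule V \<longleftrightarrow> is_ifs V \<and> 0 \<in> V \<and>
     (\<forall>Q\<subseteq>V. Q \<noteq> {} \<longrightarrow> (\<exists>h\<in>V. is_inf UNIV (sle fun_module) Q h))"

definition admissible :: "('x \<Rightarrow> 'k::idempotent_semiring) set \<Rightarrow> bool" where
  "admissible V \<longleftrightarrow>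
     (\<forall>f\<in>V. \<forall>x. \<exists>g\<in>V. g x = 1 \<and> f x \<odot>\<^bsub>fun_module\<^esub> g \<preceq>\<^bsub>fun_module\<^esub> f)"

end

theory Submission
  imports Defs
begin

text \<open>
  Admissibility together with closure under infima supplies, for every point \<open>x\<close>, a function
  \<open>d\<^sub>x\<close> in \<open>V\<close> that plays the role of a delta function: the pointwise infimum of all \<open>g\<close> in \<open>V\<close>
  with \<open>g x = 1\<close>. It still takes the value 1 at \<open>x\<close>, and since it lies below the function \<open>g\<close>
  that admissibility attaches to \<open>f\<close> and \<open>x\<close>, it satisfies \<open>f x \<odot> d\<^sub>x \<preceq> f\<close> for all \<open>f\<close> in \<open>V\<close>
  simultaneously (lemma \<open>delta_function_exists\<close>).

  Consequently \<open>f\<close> is the supremum inside \<open>V\<close> of the functions \<open>f x \<odot> d\<^sub>x\<close>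
  (lemma \<open>bigsum_delta_expansion\<close>): any bound \<open>u\<close> of them satisfies
  \<open>u x \<succeq> f x * d\<^sub>x x = f x\<close> at each \<open>x\<close>. A \<open>b\<close>-linear operator commutes with this supremum and
  with the scalars \<open>f x\<close>, so \<open>k x = A d\<^sub>x\<close> is a kernel of \<open>A\<close>.

  For operators with values in a \<open>b\<close>-subsemimodule of \<open>K(Y)\<close>, suprema of bounded sets agree with
  those taken in \<open>K(Y)\<close>, and the latter are computed pointwise
  (lemma \<open>bigsum_fun_module_apply\<close>), which turns the kernel into a function of two variables.
\<close>

section \<open>Suprema and the canonical order\<close>

lemma is_sup_unique:
  assumes "is_sup C le Q s" and "is_sup C le Q t"
    and "\<And>a b. a \<in> C \<Longrightarrow> b \<in> C \<Longrightarrow> le a b \<Longrightarrow> le b a \<Longrightarrow> a = b"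
  shows "s = t"
  using assms unfolding is_sup_def by blast

lemma bigsum_eqI:
  assumes "is_sup (carrier S) (sle S) Q s"
    and "\<And>a b. a \<in> carrier S \<Longrightarrow> b \<in> carrier S \<Longrightarrow> a \<preceq>\<^bsub>S\<^esub> b \<Longrightarrow> b \<preceq>\<^bsub>S\<^esub> a \<Longrightarrow> a = b"
  shows "\<Oplus>\<^bsub>S\<^esub>Q = s"
  unfolding bigsum_def by (rule the_equality) (use assms is_sup_unique in \<open>metis\<close>)+

lemma sle_fun_module_iff:
  "f \<preceq>\<^bsub>fun_module\<^esub> g \<longleftrightarrow> (\<forall>x. f x + g x = g x)"
  by (auto simp: sle_def fun_module_def fun_eq_iff)

lemma sle_fun_module_refl: "f \<preceq>\<^bsub>fun_module\<^esub> f"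
  by (simp add: sle_fun_module_iff plus_idem)

lemma sle_fun_module_antisym:
  assumes "f \<preceq>\<^bsub>fun_module\<^esub> g" and "g \<preceq>\<^bsub>fun_module\<^esub> f"
  shows "f = g"
  using assms by (metis (no_types, lifting) add.commute ext sle_fun_module_iff)

lemma sle_fun_module_trans:
  assumes "f \<preceq>\<^bsub>fun_module\<^esub> g" and "g \<preceq>\<^bsub>fun_module\<^esub> h"
  shows "f \<preceq>\<^bsub>fun_module\<^esub> h"
  using assms by (metis (no_types, lifting) add.assoc sle_fun_module_iff)

lemma smult_fun_module_mono:
  assumes "f \<preceq>\<^bsub>fun_module\<^esub> g"
  shows "c \<odot>\<^bsub>fun_module\<^esub> f \<preceq>\<^bsub>fun_module\<^esub> c \<odot>\<^bsub>fun_module\<^esub> g"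
  using assms by (simp add: sle_fun_module_iff) (simp add: fun_module_def flip: distrib_left)

lemma ifs_module_simps [simp]:
  "carrier (ifs_module V) = V"
  "c \<odot>\<^bsub>ifs_module V\<^esub> f = c \<odot>\<^bsub>fun_module\<^esub> f"
  by (simp_all add: ifs_module_def fun_module_def)

text \<open>
  Addition in an IFS differs from pointwise addition, yet the canonical order it induces is the
  pointwise one; hence orders in \<open>V\<close> can be checked pointwise.
\<close>

lemma sle_ifs_module_iff:
  assumes "is_ifs V" and "f \<in> V" and "g \<in> V"
  shows "f \<preceq>\<^bsub>ifs_module V\<^esub> g \<longleftrightarrow> f \<preceq>\<^bsub>fun_module\<^esub> g"
proof -
  obtain h where h: "is_sup V (sle fun_module) {f, g} h"
    using assms unfolding is_ifs_def by blast
  have "f \<oplus>\<^bsub>ifs_module V\<^esub> g = (THE h. is_sup V (sle fun_module) {f, g} h)"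
    by (simp add: ifs_module_def)
  also have "\<dots> = h"
    using h is_sup_unique[OF _ h] sle_fun_module_antisym by blast
  finally have "f \<preceq>\<^bsub>ifs_module V\<^esub> g \<longleftrightarrow> h = g"
    by (simp add: sle_def)
  also have "\<dots> \<longleftrightarrow> f \<preceq>\<^bsub>fun_module\<^esub> g"
    using h assms(3) sle_fun_module_refl sle_fun_module_antisym
    unfolding is_sup_def by blast
  finally show ?thesis .
qed

section \<open>Delta functions\<close>

text \<open>
  Infima in \<open>K(X)\<close> are pointwise, at least where the family is constant: if \<open>h x\<close> were too small,
  raising \<open>h\<close> at the single point \<open>x\<close> would give a larger lower bound.
\<close>

lemma is_inf_fun_module_const_at:
  assumes inf: "is_inf UNIV (sle fun_module) Q h" and "Q \<noteq> {}"
    and const: "\<And>q. q \<in> Q \<Longrightarrow> q x = c"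
  shows "h x = c"
proof -
  have lower: "h \<preceq>\<^bsub>fun_module\<^esub> q" if "q \<in> Q" for q
    using inf that unfolding is_inf_def by blast
  from \<open>Q \<noteq> {}\<close> obtain q where "q \<in> Q" by blast
  with lower const have le: "h x + c = c"
    by (metis sle_fun_module_iff)
  have "h(x := c) \<preceq>\<^bsub>fun_module\<^esub> q" if "q \<in> Q" for q
    using lower[OF that] const[OF that] by (simp add: sle_fun_module_iff plus_idem)
  then have "h(x := c) \<preceq>\<^bsub>fun_module\<^esub> h"
    using inf unfolding is_inf_def by blast
  then have "c + h x = h x"
    by (metis fun_upd_same sle_fun_module_iff)
  with le show ?thesis
    by (simp add: add.commute)
qed

lemma delta_function_exists:
  assumes wedge: "functional_wedge_semimodule V" and adm: "admissible V"
  obtains d where "d \<in> V" and "d x = 1"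
    and "\<And>f. f \<in> V \<Longrightarrow> f x \<odot>\<^bsub>fun_module\<^esub> d \<preceq>\<^bsub>fun_module\<^esub> f"
proof -
  define Q where "Q = {g \<in> V. g x = 1}"
  have "0 \<in> V"
    using wedge by (simp add: functional_wedge_semimodule_def)
  \<comment> \<open>Admissibility, applied to the zero function, yields a member of \<open>Q\<close>.\<close>
  then have "Q \<noteq> {}"
    using adm unfolding admissible_def Q_def by blast
  moreover have "Q \<subseteq> V"
    by (auto simp: Q_def)
  ultimately obtain d where d: "d \<in> V" "is_inf UNIV (sle fun_module) Q d"
    using wedge unfolding functional_wedge_semimodule_def by blast
  have "d x = 1"
    using is_inf_fun_module_const_at[OF d(2) \<open>Q \<noteq> {}\<close>] by (simp add: Q_def)
  moreover have "f x \<odot>\<^bsub>fun_module\<^esub> d \<preceq>\<^bsub>fun_module\<^esub> f" if f: "f \<in> V" for f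
  proof -
    obtain g where g: "g \<in> Q" "f x \<odot>\<^bsub>fun_module\<^esub> g \<preceq>\<^bsub>fun_module\<^esub> f"
      using adm f unfolding admissible_def Q_def by blast
    have "d \<preceq>\<^bsub>fun_module\<^esub> g"
      using d(2) g(1) unfolding is_inf_def by blast
    then show ?thesis
      using g(2) smult_fun_module_mono sle_fun_module_trans by blast
  qed
  ultimately show thesis
    using that d(1) by blast
qed

text \<open>
  That the supremum is formed inside \<open>V\<close> does no harm: already the single term with index \<open>x\<close>
  forces a bound to dominate \<open>f\<close> at \<open>x\<close>, because \<open>d x x = 1\<close>.
\<close>

lemma bigsum_delta_expansion:
  assumes ifs: "is_ifs V" and f: "f \<in> V"
    and d: "\<And>x. d x \<in> V" "\<And>x. d x x = 1"
      "\<And>x. f x \<odot>\<^bsub>fun_module\<^esub> d x \<preceq>\<^bsub>fun_module\<^esub> f"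
  shows "bdd (ifs_module V) (range (\<lambda>x. f x \<odot>\<^bsub>fun_module\<^esub> d x))" (is "bdd _ ?P")
    and "\<Oplus>\<^bsub>ifs_module V\<^esub>(range (\<lambda>x. f x \<odot>\<^bsub>fun_module\<^esub> d x)) = f"
proof -
  note le_iff = sle_ifs_module_iff[OF ifs]
  have sub: "f x \<odot>\<^bsub>fun_module\<^esub> d x \<in> V" for x
    using ifs d(1) unfolding is_ifs_def by blast
  have le: "f x \<odot>\<^bsub>fun_module\<^esub> d x \<preceq>\<^bsub>ifs_module V\<^esub> f" for x
    using le_iff[OF sub f] d(3) by blast
  show "bdd (ifs_module V) ?P"
    unfolding bdd_def using sub le f by auto
  show "\<Oplus>\<^bsub>ifs_module V\<^esub>?P = f"
  proof (rule bigsum_eqI)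
    have "f \<preceq>\<^bsub>ifs_module V\<^esub> u"
      if u: "u \<in> V" and bound: "\<And>x. f x \<odot>\<^bsub>fun_module\<^esub> d x \<preceq>\<^bsub>ifs_module V\<^esub> u" for u
    proof -
      have "f x + u x = u x" for x
      proof -
        have "f x \<odot>\<^bsub>fun_module\<^esub> d x \<preceq>\<^bsub>fun_module\<^esub> u"
          using bound le_iff[OF sub u] by blast
        then have "(f x \<odot>\<^bsub>fun_module\<^esub> d x) x + u x = u x"
          by (simp add: sle_fun_module_iff)
        then show ?thesis
          by (simp add: fun_module_def d(2))
      qed
      then show ?thesis
        by (simp add: le_iff[OF f u] sle_fun_module_iff)
    qed
    then show "is_sup (carrier (ifs_module V)) (sle (ifs_module V)) ?P f"
      unfolding is_sup_def using f le by auto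
  next
    fix a b
    assume "a \<in> carrier (ifs_module V)" and "b \<in> carrier (ifs_module V)"
      and "a \<preceq>\<^bsub>ifs_module V\<^esub> b" and "b \<preceq>\<^bsub>ifs_module V\<^esub> a"
    then show "a = b"
      using le_iff sle_fun_module_antisym by (metis ifs_module_simps(1))
  qed
qed

section \<open>Kernels of operators\<close>

lemma b_hom_mono:
  assumes "b_hom M N A" and "x \<in> carrier M" and "y \<in> carrier M" and "x \<preceq>\<^bsub>M\<^esub> y"
  shows "A x \<preceq>\<^bsub>N\<^esub> A y"
  using assms unfolding b_hom_def sle_def by metis

lemma b_linear_integral_representation:
  fixes W :: "('k::b_complete_idempotent_semiring, 'w) isemimodule"
  assumes wedge: "functional_wedge_semimodule V" and adm: "admissible V"
    and lin: "b_linear (ifs_module V) W A"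
  obtains k where "\<And>x. k x \<in> carrier W"
    and "\<And>f. f \<in> V \<Longrightarrow> bdd W {f x \<odot>\<^bsub>W\<^esub> k x | x. True}"
    and "\<And>f. f \<in> V \<Longrightarrow> A f = \<Oplus>\<^bsub>W\<^esub>{f x \<odot>\<^bsub>W\<^esub> k x | x. True}"
proof -
  have ifs: "is_ifs V"
    using wedge by (simp add: functional_wedge_semimodule_def)
  have hom: "b_hom (ifs_module V) W A"
    and A_smult: "\<And>c g. g \<in> V \<Longrightarrow> A (c \<odot>\<^bsub>fun_module\<^esub> g) = c \<odot>\<^bsub>W\<^esub> A g"
    using lin unfolding b_linear_def by auto
  have A_closed: "A g \<in> carrier W" if "g \<in> V" for g
    using hom that unfolding b_hom_def by simp
  have "\<exists>d. d \<in> V \<and> d x = 1 \<and> (\<forall>f\<in>V. f x \<odot>\<^bsub>fun_module\<^esub> d \<preceq>\<^bsub>fun_module\<^esub> f)" for x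
    using delta_function_exists[OF wedge adm, of x] by metis
  then obtain d where d: "\<And>x. d x \<in> V" "\<And>x. d x x = 1"
    "\<And>x f. f \<in> V \<Longrightarrow> f x \<odot>\<^bsub>fun_module\<^esub> d x \<preceq>\<^bsub>fun_module\<^esub> f"
    by metis
  have main: "bdd W {f x \<odot>\<^bsub>W\<^esub> A (d x) | x. True} \<and>
      A f = \<Oplus>\<^bsub>W\<^esub>{f x \<odot>\<^bsub>W\<^esub> A (d x) | x. True}" if f: "f \<in> V" for f
  proof
    let ?P = "range (\<lambda>x. f x \<odot>\<^bsub>fun_module\<^esub> d x)"
    note expansion = bigsum_delta_expansion[OF ifs f d(1,2) d(3)[OF f]]
    have img: "A ` ?P = {f x \<odot>\<^bsub>W\<^esub> A (d x) | x. True}"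
      using A_smult[OF d(1)] by (auto simp: image_image)
    have sub: "p \<in> V" if "p \<in> ?P" for p
      using that ifs d(1) unfolding is_ifs_def by blast
    have le: "p \<preceq>\<^bsub>ifs_module V\<^esub> f" if "p \<in> ?P" for p
      using sle_ifs_module_iff[OF ifs sub[OF that] f] d(3)[OF f] that by blast
    have "A p \<preceq>\<^bsub>W\<^esub> A f" if "p \<in> ?P" for p
      using b_hom_mono[OF hom] sub[OF that] f le[OF that] by simp
    then have "bdd W (A ` ?P)"
      unfolding bdd_def using A_closed sub f by blast
    then show "bdd W {f x \<odot>\<^bsub>W\<^esub> A (d x) | x. True}"
      unfolding img .
    have "A (\<Oplus>\<^bsub>ifs_module V\<^esub>?P) = \<Oplus>\<^bsub>W\<^esub>(A ` ?P)"
      using hom expansion(1) unfolding b_hom_def by blast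
    then show "A f = \<Oplus>\<^bsub>W\<^esub>{f x \<odot>\<^bsub>W\<^esub> A (d x) | x. True}"
      unfolding expansion(2) img .
  qed
  show thesis
  proof (rule that[of "\<lambda>x. A (d x)"])
    show "A (d x) \<in> carrier W" for x
      using A_closed d(1) .
  qed (use main in blast)+
qed

section \<open>Suprema of functions with values in the semiring\<close>

lemma univ_sg_simps [simp]: "carrier (univ_sg p) = UNIV"
  by (simp add: univ_sg_def)

lemma sle_univ_sg_iff: "a \<preceq>\<^bsub>univ_sg p\<^esub> b \<longleftrightarrow> p a b = b"
  by (simp add: sle_def univ_sg_def)

lemma bigsum_semiring_is_sup:
  fixes Q :: "'k::b_complete_idempotent_semiring set"
  assumes "bdd (univ_sg (+)) Q"
  shows "is_sup UNIV (sle (univ_sg (+))) Q (\<Oplus>\<^bsub>univ_sg (+)\<^esub>Q)"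
proof -
  obtain s where s: "is_sup (carrier (univ_sg (+))) (sle (univ_sg (+))) Q s"
    using b_complete_semigroup.sup_ex[OF b_complete_plus] assms by blast
  then have "\<Oplus>\<^bsub>univ_sg (+)\<^esub>Q = s"
    by (rule bigsum_eqI) (metis sle_univ_sg_iff add.commute)
  with s show ?thesis by simp
qed

text \<open>
  The values at a point \<open>y\<close> of a bounded family are bounded by the value of a bound, so their
  supremum in \<open>K\<close> exists by \<open>b\<close>-completeness; the function of \<open>y\<close> so obtained is the supremum
  of the family.
\<close>

lemma bigsum_fun_module_apply:
  fixes P :: "('y \<Rightarrow> 'k::b_complete_idempotent_semiring) set"
  assumes "bdd fun_module P"
  shows "(\<Oplus>\<^bsub>fun_module\<^esub>P) y = \<Oplus>\<^bsub>univ_sg (+)\<^esub>((\<lambda>p. p y) ` P)"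
proof -
  define s where "s y = \<Oplus>\<^bsub>univ_sg (+)\<^esub>((\<lambda>p. p y) ` P)" for y
  obtain u where u: "\<And>p. p \<in> P \<Longrightarrow> p \<preceq>\<^bsub>fun_module\<^esub> u"
    using assms unfolding bdd_def by blast
  have "p y + u y = u y" if "p \<in> P" for p y
    using u[OF that] by (simp add: sle_fun_module_iff)
  then have "bdd (univ_sg (+)) ((\<lambda>p. p y) ` P)" for y
    unfolding bdd_def by (auto simp: sle_univ_sg_iff)
  then have s: "is_sup UNIV (sle (univ_sg (+))) ((\<lambda>p. p y) ` P) (s y)" for y
    unfolding s_def by (rule bigsum_semiring_is_sup)
  have "\<Oplus>\<^bsub>fun_module\<^esub>P = s"
  proof (rule bigsum_eqI)
    show "is_sup (carrier fun_module) (sle fun_module) P s"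
      using s unfolding is_sup_def
      by (auto simp: sle_univ_sg_iff sle_fun_module_iff) (simp add: fun_module_def)
  qed (rule sle_fun_module_antisym)
  then show ?thesis
    by (simp add: s_def)
qed

lemma bigsum_b_subsemimodule_apply:
  fixes W :: "('y \<Rightarrow> 'k::b_complete_idempotent_semiring) set"
  assumes W: "b_subsemimodule W fun_module"
    and P: "bdd (restrict_module fun_module W) P"
  shows "(\<Oplus>\<^bsub>restrict_module fun_module W\<^esub>P) y = \<Oplus>\<^bsub>univ_sg (+)\<^esub>((\<lambda>p. p y) ` P)"
proof -
  have "\<Oplus>\<^bsub>restrict_module fun_module W\<^esub>P = \<Oplus>\<^bsub>fun_module\<^esub>P"
    using W P unfolding b_subsemimodule_def b_hom_def by simp
  moreover have "bdd fun_module P"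
    using P unfolding bdd_def sle_def restrict_module_def fun_module_def by auto
  ultimately show ?thesis
    by (simp add: bigsum_fun_module_apply)
qed

section \<open>The integral representation\<close>

theorem theorem1:
  fixes V :: "('x \<Rightarrow> 'k::b_complete_idempotent_semiring) set"
  assumes "functional_wedge_semimodule V" and "admissible V"
  shows
    "(\<forall>(W :: ('k, 'w) isemimodule) A.
        b_complete_semimodule W \<and> b_linear (ifs_module V) W A \<longrightarrow>
        (\<exists>k :: 'x \<Rightarrow> 'w.
           (\<forall>x. k x \<in> carrier W) \<and>
           (\<forall>f\<in>V. bdd W {f x \<odot>\<^bsub>W\<^esub> k x | x. True} \<and>
                  A f = \<Oplus>\<^bsub>W\<^esub>{f x \<odot>\<^bsub>W\<^esub> k x | x. True}))) \<and>
     (\<forall>(W :: ('y \<Rightarrow> 'k) set) A.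
        b_subsemimodule W fun_module \<and>
        b_linear (ifs_module V) (restrict_module fun_module W) A \<longrightarrow>
        (\<exists>k :: 'x \<times> 'y \<Rightarrow> 'k.
           (\<forall>x. (\<lambda>y. k (x, y)) \<in> W) \<and>
           (\<forall>f\<in>V. bdd (restrict_module fun_module W)
                      {f x \<odot>\<^bsub>fun_module\<^esub> (\<lambda>y. k (x, y)) | x. True} \<and>
                  (\<forall>y. A f y = \<Oplus>\<^bsub>univ_sg (+)\<^esub>{f x * k (x, y) | x. True}))))"
proof (intro conjI allI impI; elim conjE)
  fix W :: "('k, 'w) isemimodule" and A
  assume "b_linear (ifs_module V) W A"
  then obtain k where "\<And>x. k x \<in> carrier W"
    and "\<And>f. f \<in> V \<Longrightarrow> bdd W {f x \<odot>\<^bsub>W\<^esub> k x | x. True}"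
    and "\<And>f. f \<in> V \<Longrightarrow> A f = \<Oplus>\<^bsub>W\<^esub>{f x \<odot>\<^bsub>W\<^esub> k x | x. True}"
    using b_linear_integral_representation[OF assms] by blast
  then show "\<exists>k :: 'x \<Rightarrow> 'w. (\<forall>x. k x \<in> carrier W) \<and>
      (\<forall>f\<in>V. bdd W {f x \<odot>\<^bsub>W\<^esub> k x | x. True} \<and>
             A f = \<Oplus>\<^bsub>W\<^esub>{f x \<odot>\<^bsub>W\<^esub> k x | x. True})"
    by blast
next
  fix W :: "('y \<Rightarrow> 'k) set" and A
  let ?W = "restrict_module fun_module W"
  assume W: "b_subsemimodule W fun_module" and lin: "b_linear (ifs_module V) ?W A"
  have W_simps: "carrier ?W = W" "\<And>c g. c \<odot>\<^bsub>?W\<^esub> g = c \<odot>\<^bsub>fun_module\<^esub> g"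
    by (simp_all add: restrict_module_def)
  obtain k where k: "\<And>x. k x \<in> W"
    and bdd: "\<And>f. f \<in> V \<Longrightarrow> bdd ?W {f x \<odot>\<^bsub>fun_module\<^esub> k x | x. True}"
    and A: "\<And>f. f \<in> V \<Longrightarrow> A f = \<Oplus>\<^bsub>?W\<^esub>{f x \<odot>\<^bsub>fun_module\<^esub> k x | x. True}"
    using b_linear_integral_representation[OF assms lin] unfolding W_simps by blast
  have "A f y = \<Oplus>\<^bsub>univ_sg (+)\<^esub>{f x * k x y | x. True}" if f: "f \<in> V" for f y
  proof -
    have "(\<lambda>p. p y) ` {f x \<odot>\<^bsub>fun_module\<^esub> k x | x. True} = {f x * k x y | x. True}"
      by (auto simp: fun_module_def image_iff)
    then show ?thesis
      using bigsum_b_subsemimodule_apply[OF W bdd[OF f]] A[OF f] by simp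
  qed
  with k bdd show "\<exists>k :: 'x \<times> 'y \<Rightarrow> 'k. (\<forall>x. (\<lambda>y. k (x, y)) \<in> W) \<and>
      (\<forall>f\<in>V. bdd ?W {f x \<odot>\<^bsub>fun_module\<^esub> (\<lambda>y. k (x, y)) | x. True} \<and>
             (\<forall>y. A f y = \<Oplus>\<^bsub>univ_sg (+)\<^esub>{f x * k (x, y) | x. True}))"
    by (intro exI[of _ "\<lambda>(x, y). k x y"]) simp
qed

end
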